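(* Let $n\geq 4$ and let $G\neq \overline{K_n}$ be a graph of order $n$ (not necessarily connected). Then $$\frac{\sigma_1(G)}{\sigma_0(G)}\geq \frac{\sigma_1(S_n)}{\sigma_0(S_n)}.$$
   Context: All graphs are finite and simple. For a graph $G$ and an integer $k\ge 0$, $\sigma_k(G)$ denotes the number of subsets $A\subseteq V(G)$ such that the subgraph of $G$ induced by $A$ has exactly $k$ edges. Thus $\sigma_0(G)$ is the number of independent vertex subsets of $G$ (including the empty set), and $\sigma_1(G)$ is the number of vertex subsets inducing exactly one edge. The order of $G$ is its number of vertices. $S_n$ denotes the star with $n$ vertices (one centre joined to $n-1$ leaves). $\overline{K_n}$ denotes the graph with $n$ vertices and no edges. Equality of graphs is understood up to isomorphism. *)

theory Defs
  imports Complex_Main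
begin

datatype 'a graph = Graph (verts: "'a set") (edges: "'a set set")

definition simple_graph :: "'a graph \<Rightarrow> bool" where
  "simple_graph G \<longleftrightarrow> finite (verts G) \<and> (\<forall>e\<in>edges G. e \<subseteq> verts G \<and> card e = 2)"

definition order :: "'a graph \<Rightarrow> nat" where
  "order G = card (verts G)"

definition graph_iso :: "'a graph \<Rightarrow> 'b graph \<Rightarrow> bool" where
  "graph_iso G H \<longleftrightarrow> (\<exists>f. bij_betw f (verts G) (verts H) \<and>
     (\<forall>u\<in>verts G. \<forall>v\<in>verts G. {u, v} \<in> edges G \<longleftrightarrow> {f u, f v} \<in> edges H))"

definition induced_subgraph :: "'a graph \<Rightarrow> 'a set \<Rightarrow> 'a graph" where
  "induced_subgraph G A = Graph A {e \<in> edges G. e \<subseteq> A}"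

definition sigma :: "nat \<Rightarrow> 'a graph \<Rightarrow> nat" where
  "sigma k G = card {A. A \<subseteq> verts G \<and> card (edges (induced_subgraph G A)) = k}"

definition empty_graph :: "nat \<Rightarrow> nat graph" where
  "empty_graph n = Graph {..<n} {}"

text \<open>The star of order \<open>n\<close>: centre \<open>0\<close> and the \<open>n - 1\<close> leaves \<open>1, \<dots>, n - 1\<close>.\<close>
definition star_graph :: "nat \<Rightarrow> nat graph" where
  "star_graph n = Graph {..<n} {{0, i} | i. 1 \<le> i \<and> i < n}"

lemma simple_graph_empty_graph: "simple_graph (empty_graph n)"
  by (simp add: simple_graph_def empty_graph_def)

lemma order_empty_graph: "order (empty_graph n) = n"
  by (simp add: order_def empty_graph_def)

lemma simple_graph_star_graph: "simple_graph (star_graph n)"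
  by (auto simp: simple_graph_def star_graph_def card_insert_if)

lemma order_star_graph: "order (star_graph n) = n"
  by (simp add: order_def star_graph_def)

end

theory Submission
  imports Defs
begin

text \<open>
  The star has \<open>\<sigma>\<^sub>0 = 2 ^ (n - 1) + 1\<close> and \<open>\<sigma>\<^sub>1 = n - 1\<close>, so the claim is
  \<open>(n - 1) * \<sigma>\<^sub>0(G) \<le> (2 ^ (n - 1) + 1) * \<sigma>\<^sub>1(G)\<close> for every \<open>G\<close> of order \<open>n \<ge> 4\<close> with an edge.
  The proof is an induction that deletes an endpoint \<open>v\<close> of an edge \<open>uv\<close>. Write \<open>s = \<sigma>\<^sub>0(G)\<close>,
  \<open>a = \<sigma>\<^sub>0(G - v)\<close>, \<open>b = \<sigma>\<^sub>0(G - N[v])\<close> and \<open>t = \<sigma>\<^sub>0(G - N[u] - N[v])\<close>. Four facts carry it: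

  \<^item> \<open>s = a + b\<close>, by whether an independent set contains \<open>v\<close>;
  \<^item> \<open>\<sigma>\<^sub>1(G) \<ge> \<sigma>\<^sub>1(G - v) + t\<close>, since adding \<open>u\<close> and \<open>v\<close> to an independent set counted by \<open>t\<close>
    makes \<open>uv\<close> the only edge (\<open>card_one_edge_sets_ge\<close>);
  \<^item> \<open>b + t \<le> a\<close>, since adding \<open>u\<close> to the sets counted by \<open>t\<close> gives independent sets of \<open>G - v\<close>
    that meet \<open>N(v)\<close> (\<open>card_indep_sets_avoid_nbrs\<close>);
  \<^item> \<open>s \<le> (2 ^ (m - 1) + 1) * t\<close> where \<open>m\<close> is the size of \<open>N[u] \<union> N[v]\<close>: a dominating edge leaves
    only two independent sets whose complement is independent too
    (\<open>card_indep_sets_dominating_edge\<close>), so the subgraph on \<open>N[u] \<union> N[v]\<close> has at most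
    \<open>2 ^ (m - 1) + 1\<close> independent sets (\<open>card_indep_sets_le_edge\<close>).

  The star, with \<open>v\<close> a leaf, attains equality in all of them. With the bound for \<open>G - v\<close> they give
  the bound for \<open>G\<close> by arithmetic (\<open>star_ratio_step\<close>).

  The obstacle is that the bound fails for a single edge on three vertices, where \<open>\<sigma>\<^sub>1 / \<sigma>\<^sub>0\<close> is
  \<open>1 / 3\<close> rather than \<open>2 / 5\<close>. A graph with a single edge always has ratio \<open>1 / 3\<close>, which
  suffices for \<open>n \<ge> 4\<close>. So the induction runs over graphs with at least two edges, for all orders
  \<open>n \<ge> 3\<close>, and if \<open>G - v\<close> has only one edge and \<open>n \<ge> 4\<close>, then \<open>b \<le> 2 * t\<close> shows that the
  ratio is still at least \<open>1 / 3\<close>.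
\<close>

section \<open>Induced subgraphs with no edge or one edge\<close>

text \<open>The edge set \<open>E\<close> stays fixed and may reach outside \<open>V\<close>; the graph meant is the one that
  \<open>E\<close> induces on \<open>V\<close>. Deleting vertices then only shrinks \<open>V\<close>.\<close>

definition indep_sets :: "'a set set \<Rightarrow> 'a set \<Rightarrow> 'a set set" where
  "indep_sets E V = {A. A \<subseteq> V \<and> (\<forall>e\<in>E. \<not> e \<subseteq> A)}"

definition one_edge_sets :: "'a set set \<Rightarrow> 'a set \<Rightarrow> 'a set set" where
  "one_edge_sets E V = {A. A \<subseteq> V \<and> (\<exists>!e. e \<in> E \<and> e \<subseteq> A)}"

definition nbrs :: "'a set set \<Rightarrow> 'a \<Rightarrow> 'a set" where
  "nbrs E v = {w. {v, w} \<in> E}"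

lemma finite_indep_sets: "finite V \<Longrightarrow> finite (indep_sets E V)"
  by (rule finite_subset[of _ "Pow V"]) (auto simp: indep_sets_def)

lemma finite_one_edge_sets: "finite V \<Longrightarrow> finite (one_edge_sets E V)"
  by (rule finite_subset[of _ "Pow V"]) (auto simp: one_edge_sets_def)

lemma card_indep_sets_le_pow:
  assumes "finite V" shows "card (indep_sets E V) \<le> 2 ^ card V"
proof -
  have "card (indep_sets E V) \<le> card (Pow V)"
    using assms by (intro card_mono) (auto simp: indep_sets_def)
  then show ?thesis using assms by (simp add: card_Pow)
qed

text \<open>An independent set is determined by its traces on \<open>U\<close> and on \<open>V - U\<close>, both independent.\<close>

lemma card_indep_sets_le_mult:
  assumes "finite V" "U \<subseteq> V"
  shows "card (indep_sets E V) \<le> card (indep_sets E U) * card (indep_sets E (V - U))"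
proof -
  have fin: "finite (indep_sets E U \<times> indep_sets E (V - U))"
    using assms by (auto intro!: finite_indep_sets intro: finite_subset)
  have "inj_on (\<lambda>A. (A \<inter> U, A - U)) (indep_sets E V)"
    by (rule inj_onI) blast
  moreover have "(\<lambda>A. (A \<inter> U, A - U)) ` indep_sets E V \<subseteq> indep_sets E U \<times> indep_sets E (V - U)"
    by (fastforce simp: indep_sets_def)
  ultimately have "card (indep_sets E V) \<le> card (indep_sets E U \<times> indep_sets E (V - U))"
    by (rule card_inj_on_le[OF _ _ fin])
  then show ?thesis by (simp add: card_cartesian_product)
qed

section \<open>Counting around an edge\<close>

text \<open>Independent sets and their complements together are at most \<open>2 ^ card U\<close> sets, so it is
  enough that at most two sets are independent with independent complement. Such a set separates
  the ends of every edge. Every vertex is a neighbour of \<open>u\<close> or of \<open>v\<close>, so the set is determined by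
  which of \<open>u\<close> and \<open>v\<close> it contains.\<close>

lemma card_indep_sets_dominating_edge:
  assumes fin: "finite U" and uv: "{u, v} \<in> E" and U: "U \<subseteq> nbrs E u \<union> nbrs E v"
    and uU: "u \<in> U" and vU: "v \<in> U"
  shows "card (indep_sets E U) \<le> 2 ^ (card U - 1) + 1"
proof -
  let ?I = "indep_sets E U"
  let ?J = "(\<lambda>A. U - A) ` ?I"
  have I: "?I \<subseteq> Pow U" by (auto simp: indep_sets_def)
  have finI: "finite ?I" using fin by (rule finite_indep_sets)
  have inj: "inj_on (\<lambda>A. U - A) ?I"
    using I by (intro inj_onI) blast
  \<comment> \<open>The two colour classes of \<open>U\<close>, in case its graph is bipartite.\<close>
  have "?I \<inter> ?J \<subseteq> {U \<inter> nbrs E v, U \<inter> nbrs E u}"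
  proof
    fix A assume "A \<in> ?I \<inter> ?J"
    then have A: "A \<subseteq> U" "\<And>e. e \<in> E \<Longrightarrow> \<not> e \<subseteq> A" "\<And>e. e \<in> E \<Longrightarrow> \<not> e \<subseteq> U - A"
      by (auto simp: indep_sets_def double_diff)
    have sep: "x \<in> A \<longleftrightarrow> y \<notin> A" if "{x, y} \<in> E" "x \<in> U" "y \<in> U" for x y
      using A(2,3)[OF that(1)] that(2,3) by auto
    have nu: "w \<in> A \<longleftrightarrow> u \<notin> A" if "w \<in> U" "w \<in> nbrs E u" for w
      using sep[of u w] that uU by (auto simp: nbrs_def)
    have nv: "w \<in> A \<longleftrightarrow> v \<notin> A" if "w \<in> U" "w \<in> nbrs E v" for w
      using sep[of v w] that vU by (auto simp: nbrs_def)
    have "u \<in> A \<longleftrightarrow> v \<notin> A" using sep[OF uv uU vU] .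
    then have "A = (if u \<in> A then U \<inter> nbrs E v else U \<inter> nbrs E u)"
      using U A(1) nu nv by auto
    then show "A \<in> {U \<inter> nbrs E v, U \<inter> nbrs E u}" by (metis insertCI)
  qed
  then have "card (?I \<inter> ?J) \<le> card {U \<inter> nbrs E v, U \<inter> nbrs E u}"
    by (intro card_mono) auto
  also have "\<dots> \<le> 2" by (simp add: card_insert_if)
  finally have inter: "card (?I \<inter> ?J) \<le> 2" .
  have "?I \<union> ?J \<subseteq> Pow U" using I by blast
  then have un: "card (?I \<union> ?J) \<le> 2 ^ card U"
    using fin by (metis card_Pow card_mono finite_Pow_iff)
  have "2 * card ?I = card ?I + card ?J" using card_image[OF inj] by simp
  also have "\<dots> = card (?I \<union> ?J) + card (?I \<inter> ?J)"
    using finI by (intro card_Un_Int) auto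
  also have "\<dots> \<le> 2 ^ card U + 2" using inter un by simp
  also have "(2::nat) ^ card U = 2 * 2 ^ (card U - 1)"
    using fin uU by (metis card_gt_0_iff empty_iff power_minus_mult mult.commute)
  finally show ?thesis by simp
qed

lemma insert_indep_sets:
  assumes two: "\<And>e. e \<in> E \<Longrightarrow> card e = 2"
    and A: "A \<in> indep_sets E W" and W: "W \<inter> nbrs E v = {}"
  shows "insert v A \<in> indep_sets E (insert v W)"
proof -
  have "\<not> e \<subseteq> insert v A" if e: "e \<in> E" for e
  proof
    assume sub: "e \<subseteq> insert v A"
    have "\<not> e \<subseteq> A" using A e by (auto simp: indep_sets_def)
    with sub have "v \<in> e" by auto
    with two[OF e] obtain w where w: "e = {v, w}" "w \<noteq> v"
      by (auto simp: card_2_iff)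
    then have "w \<in> A" "w \<in> nbrs E v" using sub e by (auto simp: nbrs_def)
    then show False using A W by (auto simp: indep_sets_def)
  qed
  then show ?thesis using A by (auto simp: indep_sets_def)
qed

lemma card_indep_sets_vertex:
  assumes two: "\<And>e. e \<in> E \<Longrightarrow> card e = 2" and fin: "finite V" and v: "v \<in> V"
  shows "card (indep_sets E V) = card (indep_sets E (V - {v})) + card (indep_sets E (V - {v} - nbrs E v))"
proof -
  let ?B = "indep_sets E (V - {v} - nbrs E v)"
  have ins: "insert v A \<in> indep_sets E V" if "A \<in> ?B" for A
    using insert_indep_sets[OF two that, of v] v by (auto simp: indep_sets_def)
  have del: "A - {v} \<in> ?B" if A: "A \<in> indep_sets E V" "v \<in> A" for A
  proof -
    have "w \<notin> nbrs E v" if "w \<in> A" for w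
      using A that by (force simp: indep_sets_def nbrs_def)
    then show ?thesis using A(1) by (auto simp: indep_sets_def)
  qed
  have "A \<in> indep_sets E (V - {v}) \<union> insert v ` ?B" if A: "A \<in> indep_sets E V" for A
  proof (cases "v \<in> A")
    case True
    then have "A = insert v (A - {v})" by auto
    then show ?thesis using del[OF A True] by blast
  next
    case False
    then show ?thesis using A by (auto simp: indep_sets_def)
  qed
  moreover have "indep_sets E (V - {v}) \<subseteq> indep_sets E V" by (auto simp: indep_sets_def)
  ultimately have "indep_sets E V = indep_sets E (V - {v}) \<union> insert v ` ?B"
    using ins by blast
  moreover have "indep_sets E (V - {v}) \<inter> insert v ` ?B = {}"
    by (auto simp: indep_sets_def)
  moreover have "inj_on (insert v) ?B"
    by (rule inj_onI) (auto simp: indep_sets_def dest: insert_ident)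
  ultimately show ?thesis
    using fin by (simp add: card_Un_disjoint finite_indep_sets card_image)
qed

text \<open>\<open>nbrs E u\<close> contains \<open>v\<close> and \<open>nbrs E v\<close> contains \<open>u\<close>, so removing both open
  neighbourhoods removes the closed ones. Adding \<open>u\<close> and \<open>v\<close> to an independent set of the rest
  creates the edge \<open>uv\<close> and no other; all these sets contain \<open>v\<close>.\<close>

lemma card_one_edge_sets_ge:
  assumes two: "\<And>e. e \<in> E \<Longrightarrow> card e = 2" and fin: "finite V"
    and uv: "{u, v} \<in> E" "u \<in> V" "v \<in> V"
  shows "card (one_edge_sets E (V - {v})) + card (indep_sets E (V - nbrs E u - nbrs E v))
    \<le> card (one_edge_sets E V)"
proof -
  let ?T = "indep_sets E (V - nbrs E u - nbrs E v)"
  let ?f = "\<lambda>A. insert u (insert v A)"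
  have "u \<noteq> v" using two[OF uv(1)] by auto
  have sub: "?f A \<in> one_edge_sets E V" if A: "A \<in> ?T" for A
  proof -
    \<comment> \<open>Neither end alone creates an edge, so an edge inside \<open>?f A\<close> contains both.\<close>
    have "insert u A \<in> indep_sets E (insert u (V - nbrs E u - nbrs E v))"
      and "insert v A \<in> indep_sets E (insert v (V - nbrs E u - nbrs E v))"
      by (rule insert_indep_sets[OF two A]; blast)+
    then have no: "\<not> e \<subseteq> insert u A" "\<not> e \<subseteq> insert v A" if "e \<in> E" for e
      using that by (auto simp: indep_sets_def)
    have "e = {u, v}" if e: "e \<in> E" "e \<subseteq> ?f A" for e
    proof -
      have "{u, v} \<subseteq> e" using no[OF e(1)] e(2) by blast
      moreover have "finite e" "card e = card {u, v}"
        using two[OF e(1)] \<open>u \<noteq> v\<close> by (auto intro: card_ge_0_finite)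
      ultimately show ?thesis by (metis card_subset_eq)
    qed
    moreover have "?f A \<subseteq> V" using A uv by (auto simp: indep_sets_def)
    ultimately show ?thesis using uv(1) by (auto simp: one_edge_sets_def intro!: ex1I[of _ "{u, v}"])
  qed
  have notin: "u \<notin> A" "v \<notin> A" if "A \<in> ?T" for A
    using that uv by (auto simp: indep_sets_def nbrs_def insert_commute)
  have inj: "inj_on ?f ?T"
    by (rule inj_onI) (use notin in \<open>blast elim!: equalityE\<close>)
  have "one_edge_sets E (V - {v}) \<inter> ?f ` ?T = {}"
    by (auto simp: one_edge_sets_def)
  then have "card (one_edge_sets E (V - {v})) + card ?T
      = card (one_edge_sets E (V - {v}) \<union> ?f ` ?T)"
    using fin by (simp add: card_Un_disjoint finite_indep_sets finite_one_edge_sets card_image[OF inj])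
  also have "\<dots> \<le> card (one_edge_sets E V)"
    using sub fin by (intro card_mono finite_one_edge_sets Un_least image_subsetI)
      (auto simp: one_edge_sets_def subset_Diff_insert)
  finally show ?thesis .
qed

text \<open>Besides the independent sets that avoid \<open>N(v)\<close>, the graph without \<open>v\<close> has those that contain
  the neighbour \<open>u\<close> of \<open>v\<close> and otherwise avoid both neighbourhoods.\<close>

lemma card_indep_sets_avoid_nbrs:
  assumes two: "\<And>e. e \<in> E \<Longrightarrow> card e = 2" and fin: "finite V"
    and uv: "{u, v} \<in> E" "u \<in> V"
  shows "card (indep_sets E (V - {v} - nbrs E v)) + card (indep_sets E (V - nbrs E u - nbrs E v))
    \<le> card (indep_sets E (V - {v}))"
proof -
  let ?T = "indep_sets E (V - nbrs E u - nbrs E v)"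
  let ?B = "indep_sets E (V - {v} - nbrs E v)"
  have "u \<noteq> v" using two[OF uv(1)] by auto
  have v: "v \<in> nbrs E u" "u \<in> nbrs E v" using uv by (auto simp: nbrs_def insert_commute)
  have sub: "insert u A \<in> indep_sets E (V - {v})" if "A \<in> ?T" for A
  proof -
    have "insert u A \<in> indep_sets E (insert u (V - nbrs E u - nbrs E v))"
      by (rule insert_indep_sets[OF two that]) auto
    then show ?thesis using v uv \<open>u \<noteq> v\<close> by (auto simp: indep_sets_def)
  qed
  have notin: "u \<notin> A" if "A \<in> ?T" for A
    using that v by (auto simp: indep_sets_def)
  have inj: "inj_on (insert u) ?T"
    by (rule inj_onI) (metis notin insert_ident)
  have "?B \<inter> insert u ` ?T = {}"
    using v by (auto simp: indep_sets_def)
  then have "card ?B + card ?T = card (?B \<union> insert u ` ?T)"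
    using fin by (simp add: card_Un_disjoint finite_indep_sets card_image[OF inj])
  also have "\<dots> \<le> card (indep_sets E (V - {v}))"
    using sub fin by (intro card_mono finite_indep_sets) (auto simp: indep_sets_def)
  finally show ?thesis .
qed

text \<open>The edge \<open>uv\<close> dominates \<open>N[u] \<union> N[v]\<close>, and independent sets of the whole graph are at most
  as many as pairs of one there and one in the rest.\<close>

lemma card_indep_sets_le_edge:
  assumes fin: "finite V" and uv: "{u, v} \<in> E" "u \<in> V" "v \<in> V"
  shows "card (indep_sets E V)
    \<le> (2 ^ (card (V \<inter> (nbrs E u \<union> nbrs E v)) - 1) + 1) * card (indep_sets E (V - nbrs E u - nbrs E v))"
proof -
  let ?U = "V \<inter> (nbrs E u \<union> nbrs E v)"
  have "card (indep_sets E V) \<le> card (indep_sets E ?U) * card (indep_sets E (V - ?U))"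
    using fin by (intro card_indep_sets_le_mult) auto
  also have "V - ?U = V - nbrs E u - nbrs E v" by auto
  also have "card (indep_sets E ?U) \<le> 2 ^ (card ?U - 1) + 1"
    using fin uv by (intro card_indep_sets_dominating_edge[of _ u v])
      (auto simp: nbrs_def insert_commute)
  finally show ?thesis by simp
qed

section \<open>The induction\<close>

text \<open>If \<open>uv\<close> is the only edge, then \<open>N[u] \<union> N[v]\<close> is \<open>{u, v}\<close>, which has three independent
  sets, while each independent set of the rest extends by \<open>u\<close> and \<open>v\<close> to a set with one edge.\<close>

lemma single_edge_ratio:
  assumes two: "\<And>e. e \<in> E \<Longrightarrow> card e = 2" and fin: "finite V"
    and uv: "{u, v} \<in> E" "u \<in> V" "v \<in> V"
    and single: "\<And>e. e \<in> E \<Longrightarrow> e \<subseteq> V \<Longrightarrow> e = {u, v}"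
  shows "card (indep_sets E V) \<le> 3 * card (one_edge_sets E V)"
proof -
  have "u \<noteq> v" using two[OF uv(1)] by auto
  have "V \<inter> (nbrs E u \<union> nbrs E v) = {u, v}"
  proof -
    have "w \<in> {u, v}" if "w \<in> V" "w \<in> nbrs E u \<union> nbrs E v" for w
      using that single[of "{u, w}"] single[of "{v, w}"] uv by (auto simp: nbrs_def)
    then show ?thesis using uv by (auto simp: nbrs_def insert_commute)
  qed
  then have "card (indep_sets E V) \<le> 3 * card (indep_sets E (V - nbrs E u - nbrs E v))"
    using card_indep_sets_le_edge[OF fin uv] \<open>u \<noteq> v\<close> by simp
  then show ?thesis using card_one_edge_sets_ge[OF two fin uv] by simp
qed

text \<open>The arithmetic of one induction step, with \<open>k = n - 2\<close>, \<open>K = 2 ^ (n - 2)\<close>, \<open>x = \<sigma>\<^sub>1(G - v)\<close>,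
  \<open>y = \<sigma>\<^sub>1(G)\<close> and \<open>s\<close>, \<open>a\<close>, \<open>b\<close>, \<open>t\<close> as in the introduction. The third and fourth premises give
  \<open>s + t \<le> 2 * a\<close>. Multiplying the goal by \<open>2 * K + 2\<close> and splitting off \<open>k + 2 + 2 * K\<close> copies
  of \<open>s\<close>, each at most \<open>(2 * K + 1) * t\<close>, produces exactly the \<open>s + t\<close> that is needed.\<close>

lemma star_ratio_step:
  fixes K k s a b t x y :: nat
  assumes "k * a \<le> (K + 1) * x" "x + t \<le> y" "s = a + b" "b + t \<le> a" "s \<le> (2 * K + 1) * t"
  shows "(k + 1) * s \<le> (2 * K + 1) * y"
proof -
  have "(2 * K + 2) * ((k + 1) * s) = (2 * K + 1) * (k * s) + (k + 2 + 2 * K) * s"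
    by (simp add: algebra_simps)
  also have "\<dots> \<le> (2 * K + 1) * (k * s) + (k + 2 + 2 * K) * ((2 * K + 1) * t)"
    using assms(5) by (intro add_left_mono mult_left_mono) auto
  also have "\<dots> = (2 * K + 1) * (k * (s + t) + (2 * K + 2) * t)"
    by (simp add: algebra_simps)
  also have "\<dots> \<le> (2 * K + 1) * (k * (2 * a) + (2 * K + 2) * t)"
    using assms(3,4) by (intro add_mono mult_left_mono) auto
  also have "\<dots> = (2 * K + 1) * (2 * (k * a) + (2 * K + 2) * t)" by simp
  also have "\<dots> \<le> (2 * K + 1) * (2 * ((K + 1) * x) + (2 * K + 2) * t)"
    using assms(1) by (intro add_mono mult_left_mono) auto
  also have "\<dots> = (2 * K + 2) * ((2 * K + 1) * (x + t))" by (simp add: algebra_simps)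
  also have "\<dots> \<le> (2 * K + 2) * ((2 * K + 1) * y)"
    using assms(2) by (intro mult_left_mono) auto
  finally show ?thesis by (simp del: mult_Suc add: mult_le_cancel1)
qed

text \<open>The ratio \<open>1 / 3\<close> suffices as soon as \<open>m = n - 1 \<ge> 3\<close>, with equality for \<open>m = 3\<close>; for
  \<open>m = 2\<close> it falls short of \<open>2 / 5\<close>. This is where \<open>n \<ge> 4\<close> comes from.\<close>

lemma star_bound_of_third:
  fixes s y m :: nat
  assumes "m \<ge> 3" and "s \<le> 3 * y"
  shows "m * s \<le> (2 ^ m + 1) * y"
proof -
  have "3 * m \<le> 2 ^ m + 1"
    using assms(1) by (induction m rule: nat_induct_at_least) auto
  then have "3 * m * y \<le> (2 ^ m + 1) * y" by (rule mult_right_mono) simp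
  moreover have "m * s \<le> m * (3 * y)" using assms(2) by (rule mult_left_mono) simp
  ultimately show ?thesis by (simp only: ac_simps)
qed

text \<open>Two edges are required because a single edge on three vertices violates the bound. On three
  vertices the step leads to a single edge on two vertices, where the bound holds.\<close>

theorem star_ratio_two_edges:
  assumes two: "\<And>e. e \<in> E \<Longrightarrow> card e = 2" and fin: "finite V"
    and ef: "e \<in> E" "f \<in> E" "e \<subseteq> V" "f \<subseteq> V" "e \<noteq> f"
  shows "(card V - 1) * card (indep_sets E V) \<le> (2 ^ (card V - 1) + 1) * card (one_edge_sets E V)"
  using fin ef
proof (induction "card V" arbitrary: V e f rule: less_induct)
  case less
  note fin = \<open>finite V\<close>
  have "finite f" "card e = card f"
    using two less.prems(2,3) by (auto intro: card_ge_0_finite)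
  then have "\<not> e \<subseteq> f" using less.prems(6) card_subset_eq by blast
  \<comment> \<open>Deleting \<open>v\<close> leaves the edge \<open>f\<close>.\<close>
  then obtain v where v: "v \<in> e" "v \<notin> f" by auto
  then obtain u where e: "e = {u, v}" "u \<noteq> v"
    using two[OF less.prems(2)] by (auto simp: card_2_iff)
  have uv: "{u, v} \<in> E" "u \<in> V" "v \<in> V" using less.prems e by auto
  have f: "f \<subseteq> V - {v}" using less.prems v by auto
  obtain x y where xy: "f = {x, y}" "x \<noteq> y"
    using two[OF less.prems(3)] by (auto simp: card_2_iff)
  let ?t = "card (indep_sets E (V - nbrs E u - nbrs E v))"
  let ?b = "card (indep_sets E (V - {v} - nbrs E v))"
  let ?a = "card (indep_sets E (V - {v}))"
  let ?x = "card (one_edge_sets E (V - {v}))"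
  have s: "card (indep_sets E V) = ?a + ?b"
    by (rule card_indep_sets_vertex[OF two fin uv(3)])
  have one: "?x + ?t \<le> card (one_edge_sets E V)"
    by (rule card_one_edge_sets_ge[OF two fin uv])
  have bt: "?b + ?t \<le> ?a"
    by (rule card_indep_sets_avoid_nbrs[OF two fin uv(1,2)])
  have "card f \<le> card (V - {v})" using f fin by (intro card_mono) auto
  then have V3: "card V \<ge> 3" using two[OF less.prems(3)] uv fin by simp
  define k where "k = card V - 2"
  have k: "card V = k + 2" "k \<ge> 1" using V3 by (auto simp: k_def)
  have cV: "card (V - {v}) = k + 1" using k uv fin by simp
  have "card (indep_sets E V) \<le> (2 ^ (card V - 1) + 1) * ?t"
  proof -
    have "card (V \<inter> (nbrs E u \<union> nbrs E v)) \<le> card V"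
      using fin by (intro card_mono) auto
    then have "2 ^ (card (V \<inter> (nbrs E u \<union> nbrs E v)) - 1) \<le> (2::nat) ^ (card V - 1)"
      by (intro power_increasing) auto
    then show ?thesis
      by (intro order_trans[OF card_indep_sets_le_edge[OF fin uv]] mult_right_mono) auto
  qed
  then have st: "card (indep_sets E V) \<le> (2 * 2 ^ k + 1) * ?t" using k by simp
  have step: ?case if "k * ?a \<le> (2 ^ k + 1) * ?x"
    using star_ratio_step[OF that one s bt st] k by simp
  show ?case
  proof (cases "\<exists>g\<in>E. g \<subseteq> V - {v} \<and> g \<noteq> f")
    case True
    then obtain g where "g \<in> E" "g \<subseteq> V - {v}" "f \<noteq> g" by auto
    then have "k * ?a \<le> (2 ^ k + 1) * ?x"
      using less.hyps[of "V - {v}" f g] fin f less.prems cV k by simp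
    then show ?thesis by (rule step)
  next
    case False
    then have single: "\<And>g. g \<in> E \<Longrightarrow> g \<subseteq> V - {v} \<Longrightarrow> g = {x, y}" using xy by auto
    have ax: "?a \<le> 3 * ?x"
    proof (rule single_edge_ratio[OF two])
      show "{x, y} \<in> E" "x \<in> V - {v}" "y \<in> V - {v}" using less.prems(3) f xy by auto
    qed (use fin single in auto)
    show ?thesis
    proof (cases "k = 1")
      case True
      then show ?thesis using ax by (intro step) simp
    next
      case k2: False
      \<comment> \<open>A neighbour of \<open>u\<close> in \<open>?U\<close> lies on the only remaining edge, so there is at most one.\<close>
      let ?U = "(V - {v} - nbrs E v) \<inter> nbrs E u"
      have "card ?U \<le> 1"
      proof -
        have "w = w'" if w: "w \<in> ?U" "w' \<in> ?U" for w w'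
        proof -
          have "{u, w} = {x, y}" "{u, w'} = {x, y}"
            using w uv e(2) by (auto simp: nbrs_def intro!: single)
          then show ?thesis by (auto simp: doubleton_eq_iff)
        qed
        then show ?thesis using fin by (simp add: card_le_Suc0_iff_eq)
      qed
      then have "2 ^ card ?U \<le> (2::nat) ^ 1" by (intro power_increasing) auto
      then have U2: "card (indep_sets E ?U) \<le> 2"
        using card_indep_sets_le_pow[of ?U E] fin by simp
      have diff: "V - {v} - nbrs E v - ?U = V - nbrs E u - nbrs E v"
        using uv by (auto simp: nbrs_def)
      have "?b \<le> card (indep_sets E ?U) * card (indep_sets E (V - {v} - nbrs E v - ?U))"
        using fin by (intro card_indep_sets_le_mult) auto
      also have "\<dots> \<le> 2 * ?t"
        unfolding diff using U2 by (rule mult_right_mono) simp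
      finally have "?b \<le> 2 * ?t" .
      then have s3: "card (indep_sets E V) \<le> 3 * card (one_edge_sets E V)"
        using s one ax by linarith
      show ?thesis using k k2 by (intro star_bound_of_third s3) simp
    qed
  qed
qed

theorem star_ratio:
  assumes two: "\<And>e. e \<in> E \<Longrightarrow> card e = 2" and fin: "finite V"
    and e: "e \<in> E" "e \<subseteq> V" and V: "card V \<ge> 4"
  shows "(card V - 1) * card (indep_sets E V) \<le> (2 ^ (card V - 1) + 1) * card (one_edge_sets E V)"
proof (cases "\<exists>f\<in>E. f \<subseteq> V \<and> f \<noteq> e")
  case True
  then obtain f where f: "f \<in> E" "f \<subseteq> V" "e \<noteq> f" by auto
  show ?thesis by (rule star_ratio_two_edges[OF two fin e(1) f(1) e(2) f(2,3)])
next
  case False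
  obtain u v where uv: "e = {u, v}" using two[OF e(1)] by (auto simp: card_2_iff)
  then have s3: "card (indep_sets E V) \<le> 3 * card (one_edge_sets E V)"
    using e False by (intro single_edge_ratio[OF two fin, where u = u and v = v]) blast+
  show ?thesis using V by (intro star_bound_of_third s3) simp
qed

section \<open>The star and the comparison\<close>

lemma card_eq_1_iff_ex1: "card S = 1 \<longleftrightarrow> (\<exists>!x. x \<in> S)"
proof
  assume "card S = 1"
  then show "\<exists>!x. x \<in> S" by (auto simp: card_1_singleton_iff)
next
  assume "\<exists>!x. x \<in> S"
  then obtain x where "S = {x}" by blast
  then show "card S = 1" by simp
qed

lemma
  assumes "finite (verts G)"
  shows sigma_0_eq_card_indep_sets: "sigma 0 G = card (indep_sets (edges G) (verts G))"
    and sigma_1_eq_card_one_edge_sets: "sigma 1 G = card (one_edge_sets (edges G) (verts G))"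
proof -
  have fin: "finite {e \<in> edges G. e \<subseteq> A}" if "A \<subseteq> verts G" for A
    using finite_subset[OF that assms] by (rule finite_subset[rotated, OF finite_Pow_iff[THEN iffD2]]) auto
  then have "card {e \<in> edges G. e \<subseteq> A} = 0 \<longleftrightarrow> (\<forall>e\<in>edges G. \<not> e \<subseteq> A)"
    if "A \<subseteq> verts G" for A
    using that by (auto simp: card_eq_0_iff)
  then have "{A. A \<subseteq> verts G \<and> card {e \<in> edges G. e \<subseteq> A} = 0} = indep_sets (edges G) (verts G)"
    unfolding indep_sets_def by (intro Collect_cong conj_cong refl) blast
  then show "sigma 0 G = card (indep_sets (edges G) (verts G))"
    by (simp only: sigma_def induced_subgraph_def graph.sel)
  have "card {e \<in> edges G. e \<subseteq> A} = 1 \<longleftrightarrow> (\<exists>!e. e \<in> edges G \<and> e \<subseteq> A)" for A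
    using card_eq_1_iff_ex1[of "{e \<in> edges G. e \<subseteq> A}"] by simp
  then show "sigma 1 G = card (one_edge_sets (edges G) (verts G))"
    by (simp only: sigma_def induced_subgraph_def graph.sel one_edge_sets_def)
qed

lemma sigma_0_star:
  assumes "n \<ge> 1" shows "sigma 0 (star_graph n) = 2 ^ (n - 1) + 1"
proof -
  let ?I = "indep_sets (edges (star_graph n)) {..<n}"
  have edge: "{0, i} \<in> edges (star_graph n)" if "i \<noteq> 0" "i < n" for i
    using that by (auto simp: star_graph_def Suc_le_eq)
  have through_0: "0 \<in> e" "e \<noteq> {0}" if "e \<in> edges (star_graph n)" for e
    using that by (auto simp: star_graph_def)
  have "?I \<subseteq> insert {0} (Pow {1..<n})"
  proof
    fix A assume A: "A \<in> ?I"
    have "A = {0}" if "0 \<in> A"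
    proof -
      have "i = 0" if "i \<in> A" for i
        using A edge[of i] that \<open>0 \<in> A\<close> by (fastforce simp: indep_sets_def)
      then show ?thesis using that by auto
    qed
    moreover have "A \<subseteq> {1..<n}" if "0 \<notin> A"
    proof
      fix i assume "i \<in> A"
      then have "i \<noteq> 0" "i < n" using that A by (auto simp: indep_sets_def intro!: gr0I)
      then show "i \<in> {1..<n}" by simp
    qed
    ultimately show "A \<in> insert {0} (Pow {1..<n})" by blast
  qed
  moreover have "{0} \<in> ?I"
    using assms through_0 by (auto simp: indep_sets_def subset_singleton_iff)
  moreover have "Pow {1..<n} \<subseteq> ?I"
  proof
    fix A assume A: "A \<in> Pow {1..<n}"
    then have "0 \<notin> A" "A \<subseteq> {..<n}" by auto
    then show "A \<in> ?I" using through_0(1) by (auto simp: indep_sets_def)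
  qed
  ultimately have "?I = insert {0} (Pow {1..<n})" by blast
  moreover have "{0} \<notin> Pow {1..<n}" by auto
  ultimately show ?thesis
    by (simp add: sigma_0_eq_card_indep_sets star_graph_def card_Pow)
qed

lemma sigma_1_star: "sigma 1 (star_graph n) = n - 1"
proof -
  let ?E = "edges (star_graph n)"
  have "one_edge_sets ?E {..<n} = (\<lambda>i. {0, i}) ` {1..<n}"
  proof (intro equalityI subsetI)
    fix A assume A: "A \<in> one_edge_sets ?E {..<n}"
    then obtain e where e: "e \<in> ?E" "e \<subseteq> A" and uniq: "\<And>f. f \<in> ?E \<Longrightarrow> f \<subseteq> A \<Longrightarrow> f = e"
      unfolding one_edge_sets_def by blast
    from e(1) obtain i where i: "e = {0, i}" "1 \<le> i" "i < n"
      by (auto simp: star_graph_def)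
    have "j = 0 \<or> j = i" if "j \<in> A" for j
    proof (rule disjCI)
      assume "j \<noteq> i"
      show "j = 0"
      proof (rule ccontr)
        assume "j \<noteq> 0"
        moreover have "j < n" using A that by (auto simp: one_edge_sets_def)
        ultimately have "{0, j} \<in> ?E" by (auto simp: star_graph_def Suc_le_eq)
        then have "{0, j} = e" using uniq e i that by simp
        then show False using i \<open>j \<noteq> i\<close> \<open>j \<noteq> 0\<close> by (auto simp: doubleton_eq_iff)
      qed
    qed
    moreover have "{0, i} \<subseteq> A" using e i by simp
    ultimately have "A = {0, i}" by auto
    then show "A \<in> (\<lambda>i. {0, i}) ` {1..<n}" using i by auto
  next
    fix A assume "A \<in> (\<lambda>i. {0, i}) ` {1..<n}"
    then obtain i where i: "1 \<le> i" "i < n" "A = {0, i}" by auto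
    then have "e \<in> ?E \<and> e \<subseteq> A \<longleftrightarrow> e = {0, i}" for e
      by (auto simp: star_graph_def)
    then show "A \<in> one_edge_sets ?E {..<n}" using i by (auto simp: one_edge_sets_def)
  qed
  moreover have "inj_on (\<lambda>i::nat. {0, i}) {1..<n}"
    by (auto simp: inj_on_def doubleton_eq_iff)
  moreover have "sigma 1 (star_graph n) = card (one_edge_sets ?E {..<n})"
    using sigma_1_eq_card_one_edge_sets[of "star_graph n"] by (simp add: star_graph_def)
  ultimately show ?thesis by (simp add: card_image)
qed

lemma edgeless_iso_empty_graph:
  assumes "finite (verts G)" "order G = n" "edges G = {}"
  shows "graph_iso G (empty_graph n)"
proof -
  have "\<exists>f. bij_betw f (verts G) {..<n}"
    using assms by (intro finite_same_card_bij) (auto simp: order_def)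
  then show ?thesis using assms by (auto simp: graph_iso_def empty_graph_def)
qed

theorem theorem3:
  fixes G :: "'a graph" and n :: nat
  assumes "n \<ge> 4"
    and "simple_graph G"
    and "order G = n"
    and "\<not> graph_iso G (empty_graph n)"
  shows "real (sigma 1 G) / real (sigma 0 G)
           \<ge> real (sigma 1 (star_graph n)) / real (sigma 0 (star_graph n))"
proof -
  have fin: "finite (verts G)" and two: "\<And>e. e \<in> edges G \<Longrightarrow> card e = 2"
    and sub: "\<And>e. e \<in> edges G \<Longrightarrow> e \<subseteq> verts G"
    using assms(2) by (auto simp: simple_graph_def)
  obtain e where e: "e \<in> edges G"
    using edgeless_iso_empty_graph[OF fin assms(3)] assms(4) by auto
  have n: "card (verts G) = n" using assms(3) by (simp add: order_def)
  have "(n - 1) * sigma 0 G \<le> (2 ^ (n - 1) + 1) * sigma 1 G"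
    using star_ratio[OF two fin e sub[OF e]] assms(1)
    by (simp only: n sigma_0_eq_card_indep_sets[OF fin] sigma_1_eq_card_one_edge_sets[OF fin])
  then have "sigma 1 (star_graph n) * sigma 0 G \<le> sigma 1 G * sigma 0 (star_graph n)"
    using assms(1) by (simp only: sigma_0_star sigma_1_star mult.commute)
  then have le: "real (sigma 1 (star_graph n)) * real (sigma 0 G)
      \<le> real (sigma 1 G) * real (sigma 0 (star_graph n))"
    by (metis of_nat_le_iff of_nat_mult)
  have "{} \<in> indep_sets (edges G) (verts G)" using two by (fastforce simp: indep_sets_def)
  then have "sigma 0 G > 0"
    using fin by (auto simp: sigma_0_eq_card_indep_sets finite_indep_sets card_gt_0_iff)
  moreover have "sigma 0 (star_graph n) > 0" using assms(1) by (simp add: sigma_0_star)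
  ultimately show ?thesis using le by (simp add: divide_le_eq le_divide_eq field_simps)
qed

end
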